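(* Let $(M_n,g)$, $n>2$, be an $n$-dimensional Riemannian manifold with a unit vector field $\xi$ that is parallel with respect to the Levi-Civita connection $\nabla$, and let $\tilde\nabla$ be the projective semi-symmetric connection determined by $\pi=g(\cdot,\xi)$. Then $(M_n,g)$ is semi-symmetric with respect to $\tilde\nabla$, i.e. $\tilde R.\tilde R=0$, if and only if $(M_n,g)$ is flat with respect to $\nabla$, i.e. $R=0$.
   Context: $(M_n,g)$ is an $n$-dimensional Riemannian manifold with Levi-Civita connection $\nabla$; $\xi$ is a vector field with $g(\xi,\xi)=1$ and $\pi(X)=g(X,\xi)$. The projective semi-symmetric connection $\tilde\nabla$ is the linear connection $$\tilde\nabla_XY=\nabla_XY+\psi(Y)X+\psi(X)Y+\phi(Y)X-\phi(X)Y,\qquad \phi=\tfrac12\pi,\quad \psi=\tfrac{n-1}{2(n+1)}\pi ;$$ its torsion is $\tilde T(X,Y)=\pi(Y)X-\pi(X)Y$. $R$ and $\tilde R$ are the curvature tensors of $\nabla$ and $\tilde\nabla$, with $R(X,Y)Z=\nabla_X\nabla_YZ-\nabla_Y\nabla_XZ-\nabla_{[X,Y]}Z$ and likewise for $\tilde R$. The condition $\tilde R.\tilde R=0$ means that for all vector fields $X,Y,Z,U,V$, $$\tilde R(X,Y)\tilde R(Z,U)V-\tilde R(\tilde R(X,Y)Z,U)V-\tilde R(Z,\tilde R(X,Y)U)V-\tilde R(Z,U)\tilde R(X,Y)V=0.$$ *)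

theory Defs
  imports "HOL-Analysis.Analysis" "HOL-Library.Function_Algebras"
begin

text \<open>Only meaningful for open \<open>S\<close>, which is how it is used below.\<close>

primrec higher_differentiable_on ::
    "nat \<Rightarrow> 'e::euclidean_space set \<Rightarrow> ('e \<Rightarrow> 'f::real_normed_vector) \<Rightarrow> bool"
  where
    "higher_differentiable_on 0 S f \<longleftrightarrow> continuous_on S f"
  | "higher_differentiable_on (Suc k) S f \<longleftrightarrow>
       (\<forall>x\<in>S. f differentiable (at x)) \<and>
       (\<forall>v. higher_differentiable_on k S (\<lambda>x. frechet_derivative f (at x) v))"

definition smooth_on :: "'e::euclidean_space set \<Rightarrow> ('e \<Rightarrow> 'f::real_normed_vector) \<Rightarrow> bool"
  where "smooth_on S f \<longleftrightarrow> (\<forall>k. higher_differentiable_on k S f)"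

type_synonym ('a, 'e) chart = "'a set \<times> ('a \<Rightarrow> 'e)"

definition is_chart :: "'a topology \<Rightarrow> ('a, 'e::euclidean_space) chart \<Rightarrow> bool"
  where "is_chart M c \<longleftrightarrow> (case c of (U, \<phi>) \<Rightarrow>
    openin M U \<and> open (\<phi> ` U) \<and>
    homeomorphic_map (subtopology M U) (top_of_set (\<phi> ` U)) \<phi>)"

definition smooth_atlas :: "'a topology \<Rightarrow> ('a, 'e::euclidean_space) chart set \<Rightarrow> bool"
  where "smooth_atlas M A \<longleftrightarrow>
    (\<forall>c\<in>A. is_chart M c) \<and>
    (\<Union>(U, \<phi>)\<in>A. U) = topspace M \<and>
    (\<forall>(U, \<phi>)\<in>A. \<forall>(V, \<psi>)\<in>A. smooth_on (\<phi> ` (U \<inter> V)) (\<psi> \<circ> inv_into U \<phi>))"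

text \<open>The dimension of the manifold is the dimension \<open>DIM('e)\<close> of the model space. The atlas need
  not be maximal.\<close>

definition smooth_manifold :: "'a topology \<Rightarrow> ('a, 'e::euclidean_space) chart set \<Rightarrow> bool"
  where "smooth_manifold M A \<longleftrightarrow>
    Hausdorff_space M \<and> second_countable M \<and> smooth_atlas M A"

text \<open>Functions, tangent vectors and vector fields are total HOL functions; each is set to 0 outside
  its domain, so that HOL equality is equality of the mathematical objects.\<close>

definition smooth_functions ::
    "'a topology \<Rightarrow> ('a, 'e::euclidean_space) chart set \<Rightarrow> ('a \<Rightarrow> real) set"
  where "smooth_functions M A =
    {f. (\<forall>p. p \<notin> topspace M \<longrightarrow> f p = 0) \<and>
        (\<forall>(U, \<phi>)\<in>A. smooth_on (\<phi> ` U) (f \<circ> inv_into U \<phi>))}"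

text \<open>Tangent vectors at a point are the derivations at that point of the algebra of smooth
  functions.\<close>

type_synonym 'a tangent_vector = "('a \<Rightarrow> real) \<Rightarrow> real"

definition tangent_space ::
    "'a topology \<Rightarrow> ('a, 'e::euclidean_space) chart set \<Rightarrow> 'a \<Rightarrow> 'a tangent_vector set"
  where "tangent_space M A p =
    {v. (\<forall>f\<in>smooth_functions M A. \<forall>h\<in>smooth_functions M A. v (f + h) = v f + v h) \<and>
        (\<forall>c. \<forall>f\<in>smooth_functions M A. v (\<lambda>q. c * f q) = c * v f) \<and>
        (\<forall>f\<in>smooth_functions M A. \<forall>h\<in>smooth_functions M A. v (f * h) = f p * v h + h p * v f) \<and>
        (\<forall>f. f \<notin> smooth_functions M A \<longrightarrow> v f = 0)}"

type_synonym 'a vfield = "'a \<Rightarrow> 'a tangent_vector"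

definition vector_fields ::
    "'a topology \<Rightarrow> ('a, 'e::euclidean_space) chart set \<Rightarrow> 'a vfield set"
  where "vector_fields M A =
    {X. (\<forall>p\<in>topspace M. X p \<in> tangent_space M A p) \<and>
        (\<forall>p. p \<notin> topspace M \<longrightarrow> X p = 0) \<and>
        (\<forall>f\<in>smooth_functions M A. (\<lambda>p. X p f) \<in> smooth_functions M A)}"

definition fun_scale :: "('a \<Rightarrow> real) \<Rightarrow> 'a vfield \<Rightarrow> 'a vfield"  (infixr "\<odot>" 75)
  where "f \<odot> X = (\<lambda>p h. f p * X p h)"

definition lie_bracket :: "'a vfield \<Rightarrow> 'a vfield \<Rightarrow> 'a vfield"
  where "lie_bracket X Y = (\<lambda>p f. X p (\<lambda>q. Y q f) - Y p (\<lambda>q. X q f))"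


type_synonym 'a metric_field = "'a \<Rightarrow> 'a tangent_vector \<Rightarrow> 'a tangent_vector \<Rightarrow> real"

definition metric_fun ::
    "'a topology \<Rightarrow> 'a metric_field \<Rightarrow> 'a vfield \<Rightarrow> 'a vfield \<Rightarrow> 'a \<Rightarrow> real"
  where "metric_fun M g X Y = (\<lambda>p. if p \<in> topspace M then g p (X p) (Y p) else 0)"

definition riemannian_metric ::
    "'a topology \<Rightarrow> ('a, 'e::euclidean_space) chart set \<Rightarrow> 'a metric_field \<Rightarrow> bool"
  where "riemannian_metric M A g \<longleftrightarrow>
    (\<forall>p\<in>topspace M.
       (\<forall>u\<in>tangent_space M A p. \<forall>v\<in>tangent_space M A p. \<forall>w\<in>tangent_space M A p.
          g p (u + v) w = g p u w + g p v w) \<and>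
       (\<forall>c. \<forall>v\<in>tangent_space M A p. \<forall>w\<in>tangent_space M A p.
          g p (\<lambda>f. c * v f) w = c * g p v w) \<and>
       (\<forall>v\<in>tangent_space M A p. \<forall>w\<in>tangent_space M A p. g p v w = g p w v) \<and>
       (\<forall>v\<in>tangent_space M A p. v \<noteq> 0 \<longrightarrow> g p v v > 0)) \<and>
    (\<forall>X\<in>vector_fields M A. \<forall>Y\<in>vector_fields M A. metric_fun M g X Y \<in> smooth_functions M A)"

definition riemannian_manifold ::
    "'a topology \<Rightarrow> ('a, 'e::euclidean_space) chart set \<Rightarrow> 'a metric_field \<Rightarrow> bool"
  where "riemannian_manifold M A g \<longleftrightarrow> smooth_manifold M A \<and> riemannian_metric M A g"

type_synonym 'a connection = "'a vfield \<Rightarrow> 'a vfield \<Rightarrow> 'a vfield"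

definition linear_connection ::
    "'a topology \<Rightarrow> ('a, 'e::euclidean_space) chart set \<Rightarrow> 'a connection \<Rightarrow> bool"
  where "linear_connection M A D \<longleftrightarrow>
    (\<forall>X\<in>vector_fields M A. \<forall>Y\<in>vector_fields M A. D X Y \<in> vector_fields M A) \<and>
    (\<forall>X\<in>vector_fields M A. \<forall>Y\<in>vector_fields M A. \<forall>Z\<in>vector_fields M A.
       D (X + Y) Z = D X Z + D Y Z) \<and>
    (\<forall>f\<in>smooth_functions M A. \<forall>X\<in>vector_fields M A. \<forall>Y\<in>vector_fields M A.
       D (f \<odot> X) Y = f \<odot> D X Y) \<and>
    (\<forall>X\<in>vector_fields M A. \<forall>Y\<in>vector_fields M A. \<forall>Z\<in>vector_fields M A.
       D X (Y + Z) = D X Y + D X Z) \<and>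
    (\<forall>c. \<forall>X\<in>vector_fields M A. \<forall>Y\<in>vector_fields M A.
       D X ((\<lambda>_. c) \<odot> Y) = (\<lambda>_. c) \<odot> D X Y) \<and>
    (\<forall>f\<in>smooth_functions M A. \<forall>X\<in>vector_fields M A. \<forall>Y\<in>vector_fields M A.
       D X (f \<odot> Y) = (\<lambda>p. X p f) \<odot> Y + f \<odot> D X Y)"

definition torsion :: "'a connection \<Rightarrow> 'a vfield \<Rightarrow> 'a vfield \<Rightarrow> 'a vfield"
  where "torsion D X Y = D X Y - D Y X - lie_bracket X Y"

definition metric_connection ::
    "'a topology \<Rightarrow> ('a, 'e::euclidean_space) chart set \<Rightarrow> 'a metric_field \<Rightarrow> 'a connection \<Rightarrow> bool"
  where "metric_connection M A g D \<longleftrightarrow>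
    (\<forall>X\<in>vector_fields M A. \<forall>Y\<in>vector_fields M A. \<forall>Z\<in>vector_fields M A.
       (\<lambda>p. X p (metric_fun M g Y Z)) = metric_fun M g (D X Y) Z + metric_fun M g Y (D X Z))"

definition levi_civita_connection ::
    "'a topology \<Rightarrow> ('a, 'e::euclidean_space) chart set \<Rightarrow> 'a metric_field \<Rightarrow> 'a connection \<Rightarrow> bool"
  where "levi_civita_connection M A g D \<longleftrightarrow>
    linear_connection M A D \<and>
    (\<forall>X\<in>vector_fields M A. \<forall>Y\<in>vector_fields M A. torsion D X Y = 0) \<and>
    metric_connection M A g D"

definition unit_vector_field :: "'a topology \<Rightarrow> 'a metric_field \<Rightarrow> 'a vfield \<Rightarrow> bool"
  where "unit_vector_field M g \<xi> \<longleftrightarrow> (\<forall>p\<in>topspace M. metric_fun M g \<xi> \<xi> p = 1)"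

definition parallel_vector_field ::
    "'a topology \<Rightarrow> ('a, 'e::euclidean_space) chart set \<Rightarrow> 'a connection \<Rightarrow> 'a vfield \<Rightarrow> bool"
  where "parallel_vector_field M A D \<xi> \<longleftrightarrow> (\<forall>X\<in>vector_fields M A. D X \<xi> = 0)"

definition curvature ::
    "'a connection \<Rightarrow> 'a vfield \<Rightarrow> 'a vfield \<Rightarrow> 'a vfield \<Rightarrow> 'a vfield"
  where "curvature D X Y Z = D X (D Y Z) - D Y (D X Z) - D (lie_bracket X Y) Z"

definition flat_connection ::
    "'a topology \<Rightarrow> ('a, 'e::euclidean_space) chart set \<Rightarrow> 'a connection \<Rightarrow> bool"
  where "flat_connection M A D \<longleftrightarrow>
    (\<forall>X\<in>vector_fields M A. \<forall>Y\<in>vector_fields M A. \<forall>Z\<in>vector_fields M A. curvature D X Y Z = 0)"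

definition semi_symmetric ::
    "'a topology \<Rightarrow> ('a, 'e::euclidean_space) chart set \<Rightarrow> 'a connection \<Rightarrow> bool"
  where "semi_symmetric M A D \<longleftrightarrow>
    (\<forall>X\<in>vector_fields M A. \<forall>Y\<in>vector_fields M A. \<forall>Z\<in>vector_fields M A.
     \<forall>U\<in>vector_fields M A. \<forall>V\<in>vector_fields M A.
       curvature D X Y (curvature D Z U V)
       - curvature D (curvature D X Y Z) U V
       - curvature D Z (curvature D X Y U) V
       - curvature D Z U (curvature D X Y V) = 0)"

definition projective_semi_symmetric_connection ::
    "nat \<Rightarrow> ('a vfield \<Rightarrow> 'a \<Rightarrow> real) \<Rightarrow> 'a connection \<Rightarrow> 'a connection"
  where "projective_semi_symmetric_connection n \<pi> D X Y =
    (let \<phi> = (\<lambda>Z p. 1 / 2 * \<pi> Z p);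
         \<psi> = (\<lambda>Z p. (real n - 1) / (2 * (real n + 1)) * \<pi> Z p)
     in D X Y + \<psi> Y \<odot> X + \<psi> X \<odot> Y + \<phi> Y \<odot> X - \<phi> X \<odot> Y)"

end

theory Submission
  imports Defs
begin

text \<open>
  Write \<open>a = n / (n + 1)\<close>. Because \<open>\<xi>\<close> is parallel and \<open>\<nabla>\<close> is torsion free, all derivative terms in the
  curvature of the new connection cancel and
  \<open>R' X Y Z = R X Y Z + a\<^sup>2 \<pi>(Z) (\<pi>(Y) X - \<pi>(X) Y)\<close>.
  If \<open>R = 0\<close>, then \<open>R'.R' = 0\<close> is a direct computation, as \<open>\<pi>\<close> vanishes on the values of \<open>R'\<close>.
  Conversely, \<open>R\<close> vanishes as soon as one of its arguments is a multiple of \<open>\<xi>\<close>; evaluating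
  \<open>R'.R' = 0\<close> on \<open>X, \<xi>, Z, U, \<xi>\<close> with \<open>X, Z, U\<close> orthogonal to \<open>\<xi>\<close> leaves only \<open>a\<^sup>2 R Z U X = 0\<close>.
\<close>

section \<open>Algebra of smooth functions\<close>

text \<open>On an open set, agreement on \<open>S\<close> is agreement near each point, so all
  Frechet derivatives agree too. This lets the derivative of a sum or product be replaced by its
  explicit formula.\<close>

lemma higher_differentiable_on_cong:
  assumes "open S" "\<And>x. x \<in> S \<Longrightarrow> f x = h x" "higher_differentiable_on k S f"
  shows "higher_differentiable_on k S h"
  using assms(2,3)
proof (induction k arbitrary: f h)
  case 0
  then show ?case
    using continuous_on_cong[of S S f h] by simp
next
  case (Suc k)
  have hder: "(h has_derivative frechet_derivative f (at x)) (at x)" if "x \<in> S" for x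
  proof -
    have "(f has_derivative frechet_derivative f (at x)) (at x)"
      using Suc.prems that frechet_derivative_works by auto
    then show ?thesis
      using has_derivative_transform_within_open[OF _ \<open>open S\<close> that] Suc.prems(1) by blast
  qed
  have "frechet_derivative f (at x) v = frechet_derivative h (at x) v" if "x \<in> S" for x v
    using frechet_derivative_at[OF hder[OF that]] by simp
  moreover have "higher_differentiable_on k S (\<lambda>x. frechet_derivative f (at x) v)" for v
    using Suc.prems(2) by simp
  ultimately have "higher_differentiable_on k S (\<lambda>x. frechet_derivative h (at x) v)" for v
    by (rule Suc.IH)
  then show ?case
    using hder by (auto simp: differentiable_def)
qed

lemma higher_differentiable_on_SucD:
  "higher_differentiable_on (Suc k) S f \<Longrightarrow> higher_differentiable_on k S f"
proof (induction k arbitrary: f)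
  case 0
  then show ?case
    by (auto intro!: continuous_at_imp_continuous_on differentiable_imp_continuous_within)
next
  case (Suc k)
  have "\<forall>x\<in>S. f differentiable (at x)"
    and "higher_differentiable_on (Suc k) S (\<lambda>x. frechet_derivative f (at x) v)" for v
    using Suc.prems higher_differentiable_on.simps(2) by blast+
  then show ?case
    using Suc.IH by simp
qed

lemma higher_differentiable_on_add:
  assumes "open S" "higher_differentiable_on k S f" "higher_differentiable_on k S h"
  shows "higher_differentiable_on k S (\<lambda>x. f x + h x)"
  using assms(2,3)
proof (induction k arbitrary: f h)
  case 0
  then show ?case by (simp add: continuous_on_add)
next
  case (Suc k)
  have der: "((\<lambda>x. f x + h x) has_derivative
      (\<lambda>v. frechet_derivative f (at x) v + frechet_derivative h (at x) v)) (at x)" if "x \<in> S" for x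
    using Suc.prems that by (auto intro!: has_derivative_add simp: frechet_derivative_works[symmetric])
  have "higher_differentiable_on k S
      (\<lambda>x. frechet_derivative f (at x) v + frechet_derivative h (at x) v)" for v
    using Suc by simp
  then have "higher_differentiable_on k S (\<lambda>x. frechet_derivative (\<lambda>x. f x + h x) (at x) v)" for v
    by (rule higher_differentiable_on_cong[OF \<open>open S\<close>, rotated])
       (simp add: frechet_derivative_at[OF der, symmetric])
  then show ?case
    using der by (auto simp: differentiable_def)
qed

lemma higher_differentiable_on_mult:
  fixes f h :: "'e::euclidean_space \<Rightarrow> real"
  assumes "open S" "higher_differentiable_on k S f" "higher_differentiable_on k S h"
  shows "higher_differentiable_on k S (\<lambda>x. f x * h x)"
  using assms(2,3)
proof (induction k arbitrary: f h)
  case 0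
  then show ?case by (simp add: continuous_on_mult)
next
  case (Suc k)
  have der: "((\<lambda>x. f x * h x) has_derivative
      (\<lambda>v. f x * frechet_derivative h (at x) v + frechet_derivative f (at x) v * h x)) (at x)"
    if "x \<in> S" for x
    using Suc.prems that by (auto intro!: has_derivative_mult simp: frechet_derivative_works[symmetric])
  \<comment> \<open>The product rule keeps undifferentiated factors, which must be lowered to order
    \<open>k\<close> before the induction hypothesis applies.\<close>
  have "higher_differentiable_on k S f" "higher_differentiable_on k S h"
    using Suc.prems higher_differentiable_on_SucD by blast+
  then have "higher_differentiable_on k S
      (\<lambda>x. f x * frechet_derivative h (at x) v + frechet_derivative f (at x) v * h x)" for v
    using Suc by (intro higher_differentiable_on_add \<open>open S\<close> Suc.IH) auto
  then have "higher_differentiable_on k S (\<lambda>x. frechet_derivative (\<lambda>x. f x * h x) (at x) v)" for v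
    by (rule higher_differentiable_on_cong[OF \<open>open S\<close>, rotated])
       (simp add: frechet_derivative_at[OF der, symmetric])
  then show ?case
    using der by (auto simp: differentiable_def)
qed

lemma higher_differentiable_on_const: "higher_differentiable_on k S (\<lambda>_. c)"
proof (induction k arbitrary: c)
  case (Suc k)
  then show ?case by simp
qed simp

locale smooth_mfd =
  fixes M :: "'a topology" and A :: "('a, 'e::euclidean_space) chart set"
  assumes smooth_manifold: "smooth_manifold M A"
begin

abbreviation "F \<equiv> smooth_functions M A"
abbreviation "VF \<equiv> vector_fields M A"

lemma chart_image_open: "(U, \<phi>) \<in> A \<Longrightarrow> open (\<phi> ` U)"
  using smooth_manifold unfolding smooth_manifold_def smooth_atlas_def is_chart_def by blast

lemma F_add: "f \<in> F \<Longrightarrow> h \<in> F \<Longrightarrow> (\<lambda>p. f p + h p) \<in> F"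
  unfolding smooth_functions_def smooth_on_def
  by (auto simp: comp_def intro!: higher_differentiable_on_add chart_image_open)

lemma F_mult: "f \<in> F \<Longrightarrow> h \<in> F \<Longrightarrow> (\<lambda>p. f p * h p) \<in> F"
  unfolding smooth_functions_def smooth_on_def
  by (auto simp: comp_def intro!: higher_differentiable_on_mult chart_image_open)

text \<open>Not an instance of \<open>F_mult\<close>: members of \<open>F\<close> vanish off
  \<open>topspace M\<close>, so a constant function need not belong to \<open>F\<close>. The same
  reason lies behind \<open>VF_cscale\<close>.\<close>

lemma F_cmult: "f \<in> F \<Longrightarrow> (\<lambda>p. c * f p) \<in> F"
  unfolding smooth_functions_def smooth_on_def
  by (auto simp: comp_def
      intro!: higher_differentiable_on_mult higher_differentiable_on_const chart_image_open)

section \<open>Vector fields\<close>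

lemma VF_outside: "X \<in> VF \<Longrightarrow> p \<notin> topspace M \<Longrightarrow> X p f = 0"
  by (simp add: vector_fields_def)

lemma VF_tangent: "X \<in> VF \<Longrightarrow> p \<in> topspace M \<Longrightarrow> X p \<in> tangent_space M A p"
  by (simp add: vector_fields_def)

lemma VF_apply: "X \<in> VF \<Longrightarrow> f \<in> F \<Longrightarrow> (\<lambda>p. X p f) \<in> F"
  by (simp add: vector_fields_def)

lemma VF_fun_add:
  assumes "X \<in> VF" "f \<in> F" "h \<in> F" shows "X p (\<lambda>q. f q + h q) = X p f + X p h"
proof (cases "p \<in> topspace M")
  case True
  then show ?thesis
    using VF_tangent[OF assms(1) True] assms(2,3) unfolding tangent_space_def plus_fun_def by blast
qed (use assms in \<open>simp add: VF_outside\<close>)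

lemma VF_fun_cmult:
  assumes "X \<in> VF" "f \<in> F" shows "X p (\<lambda>q. c * f q) = c * X p f"
proof (cases "p \<in> topspace M")
  case True
  then show ?thesis
    using VF_tangent[OF assms(1) True] assms(2) unfolding tangent_space_def by blast
qed (use assms in \<open>simp add: VF_outside\<close>)

lemma VF_fun_diff:
  assumes "X \<in> VF" "f \<in> F" "h \<in> F" shows "X p (\<lambda>q. f q - h q) = X p f - X p h"
  using VF_fun_add[OF assms(1,2) F_cmult[OF assms(3), of "-1"], of p]
    VF_fun_cmult[OF assms(1,3), of p "-1"] by simp

lemma tangent_add:
  assumes "u \<in> tangent_space M A p" "v \<in> tangent_space M A p"
  shows "u + v \<in> tangent_space M A p"
  using assms unfolding tangent_space_def by (auto simp: algebra_simps)

lemma tangent_scale: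
  assumes "u \<in> tangent_space M A p"
  shows "(\<lambda>f. c * u f) \<in> tangent_space M A p"
  using assms unfolding tangent_space_def by (auto simp: algebra_simps)

lemma VF_add: "X \<in> VF \<Longrightarrow> Y \<in> VF \<Longrightarrow> X + Y \<in> VF"
  by (auto simp: vector_fields_def tangent_add F_add)

lemma VF_scale: "f \<in> F \<Longrightarrow> X \<in> VF \<Longrightarrow> f \<odot> X \<in> VF"
  by (auto simp: vector_fields_def fun_scale_def tangent_scale F_mult zero_fun_def)

lemma VF_cscale: "X \<in> VF \<Longrightarrow> (\<lambda>_. c) \<odot> X \<in> VF"
  by (auto simp: vector_fields_def fun_scale_def tangent_scale F_cmult zero_fun_def)

lemma VF_diff: assumes "X \<in> VF" "Y \<in> VF" shows "X - Y \<in> VF"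
proof -
  have "X - Y = X + (\<lambda>_. -1) \<odot> Y"
    by (auto simp: fun_eq_iff fun_scale_def)
  then show ?thesis
    using VF_add[OF assms(1) VF_cscale[OF assms(2), of "-1"]] by (simp only:)
qed

lemma VF_zero: assumes "X \<in> VF" shows "0 \<in> VF"
  using VF_diff[OF assms assms] by simp

lemma jacobi:
  assumes "X \<in> VF" "Y \<in> VF" "Z \<in> VF" "f \<in> F"
  shows "lie_bracket X (lie_bracket Y Z) p f + lie_bracket Y (lie_bracket Z X) p f
    + lie_bracket Z (lie_bracket X Y) p f = 0"
proof -
  \<comment> \<open>Here \<open>A\<close>, \<open>B\<close>, \<open>C\<close> are vector fields,
    \<open>A\<close> shadowing the atlas. Once the outer derivative is split over the difference,
    the twelve third-order terms cancel in pairs.\<close>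
  have "A p (\<lambda>q. B q (\<lambda>r. C r f) - C q (\<lambda>r. B r f))
      = A p (\<lambda>q. B q (\<lambda>r. C r f)) - A p (\<lambda>q. C q (\<lambda>r. B r f))"
    if "A \<in> VF" "B \<in> VF" "C \<in> VF" for A B C
    using VF_fun_diff[OF that(1) VF_apply[OF that(2) VF_apply[OF that(3) assms(4)]]
        VF_apply[OF that(3) VF_apply[OF that(2) assms(4)]]] .
  note this[OF assms(1-3)] this[OF assms(2,3,1)] this[OF assms(3,1,2)]
  then show ?thesis
    by (simp add: lie_bracket_def)
qed

text \<open>The default values settle the rest: fields are zero off \<open>topspace M\<close>, and
  tangent vectors are zero on functions outside \<open>F\<close>.\<close>

lemma VF_eqI:
  assumes "X \<in> VF" "Y \<in> VF" "\<And>p f. p \<in> topspace M \<Longrightarrow> f \<in> F \<Longrightarrow> X p f = Y p f"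
  shows "X = Y"
proof (intro ext)
  fix p f
  show "X p f = Y p f"
  proof (cases "p \<in> topspace M \<and> f \<in> F")
    case False
    have "X p f = 0 \<and> Y p f = 0"
    proof (cases "p \<in> topspace M")
      case True
      then show ?thesis
        using VF_tangent[OF assms(1) True] VF_tangent[OF assms(2) True] False
        unfolding tangent_space_def by blast
    qed (simp add: VF_outside assms)
    then show ?thesis by simp
  qed (use assms in blast)
qed

end

section \<open>Curvature of the Levi-Civita connection\<close>

locale levi_civita = smooth_mfd M A
  for M :: "'a topology" and A :: "('a, 'e::euclidean_space) chart set" +
  fixes g :: "'a metric_field" and D :: "'a connection"
  assumes metric: "riemannian_metric M A g" and levi_civita: "levi_civita_connection M A g D"
begin

abbreviation "R \<equiv> curvature D"
abbreviation "mf \<equiv> metric_fun M g"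

section \<open>Pointwise algebra of the metric\<close>

lemma mf_F: "X \<in> VF \<Longrightarrow> Y \<in> VF \<Longrightarrow> mf X Y \<in> F"
  using metric by (simp add: riemannian_metric_def)

lemma mf_add: "X \<in> VF \<Longrightarrow> Y \<in> VF \<Longrightarrow> Z \<in> VF \<Longrightarrow> mf (X + Y) Z p = mf X Z p + mf Y Z p"
  using metric by (simp add: riemannian_metric_def metric_fun_def VF_tangent)

lemma mf_sym: "X \<in> VF \<Longrightarrow> Y \<in> VF \<Longrightarrow> mf X Y p = mf Y X p"
  using metric by (simp add: riemannian_metric_def metric_fun_def VF_tangent)

lemma mf_scale: "X \<in> VF \<Longrightarrow> Z \<in> VF \<Longrightarrow> mf (f \<odot> X) Z p = f p * mf X Z p"
  using metric by (simp add: riemannian_metric_def metric_fun_def VF_tangent fun_scale_def)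

lemma mf_diff: "X \<in> VF \<Longrightarrow> Y \<in> VF \<Longrightarrow> Z \<in> VF \<Longrightarrow> mf (X - Y) Z p = mf X Z p - mf Y Z p"
  using mf_add[of "X - Y" Y Z p] VF_diff[of X Y] by simp

lemma mf_zero: "Z \<in> VF \<Longrightarrow> mf 0 Z p = 0" "Z \<in> VF \<Longrightarrow> mf Z 0 p = 0"
  using mf_diff[of Z Z Z p] mf_sym[of Z 0 p] VF_zero[of Z] by auto

lemma mf_definite:
  assumes "X \<in> VF" "\<And>p. mf X X p = 0" shows "X = 0"
proof (rule ext)
  fix p
  show "X p = 0 p"
  proof (cases "p \<in> topspace M")
    case True
    have "\<not> g p (X p) (X p) > 0"
      using assms(2)[of p] True by (simp add: metric_fun_def)
    then show ?thesis
      using metric True VF_tangent[OF assms(1) True] by (auto simp: riemannian_metric_def)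
  qed (use assms(1) in \<open>simp add: vector_fields_def\<close>)
qed

section \<open>Rules for the Levi-Civita connection\<close>

lemma D_VF: "X \<in> VF \<Longrightarrow> Y \<in> VF \<Longrightarrow> D X Y \<in> VF"
  and D_add1: "X \<in> VF \<Longrightarrow> Y \<in> VF \<Longrightarrow> Z \<in> VF \<Longrightarrow> D (X + Y) Z = D X Z + D Y Z"
  and D_add2: "X \<in> VF \<Longrightarrow> Y \<in> VF \<Longrightarrow> Z \<in> VF \<Longrightarrow> D X (Y + Z) = D X Y + D X Z"
  and D_scale2: "f \<in> F \<Longrightarrow> X \<in> VF \<Longrightarrow> Y \<in> VF \<Longrightarrow> D X (f \<odot> Y) = (\<lambda>p. X p f) \<odot> Y + f \<odot> D X Y"
  and D_cscale2: "X \<in> VF \<Longrightarrow> Y \<in> VF \<Longrightarrow> D X ((\<lambda>_. c) \<odot> Y) = (\<lambda>_. c) \<odot> D X Y"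
  using levi_civita by (simp_all add: levi_civita_connection_def linear_connection_def)

text \<open>Eliminates brackets in favour of \<open>D\<close>, so that curvature identities follow
  from additivity of \<open>D\<close> alone.\<close>

lemma lie_bracket_D:
  assumes "X \<in> VF" "Y \<in> VF" shows "lie_bracket X Y = D X Y - D Y X"
proof -
  have "D X Y - D Y X - lie_bracket X Y = 0"
    using levi_civita assms by (simp add: levi_civita_connection_def torsion_def)
  then show ?thesis by (simp only: right_minus_eq)
qed

lemma D_metric:
  assumes "X \<in> VF" "Y \<in> VF" "Z \<in> VF"
  shows "X p (mf Y Z) = mf (D X Y) Z p + mf Y (D X Z) p"
  using levi_civita assms
  by (simp add: levi_civita_connection_def metric_connection_def fun_eq_iff)

lemma D_diff1:
  assumes "X \<in> VF" "Y \<in> VF" "Z \<in> VF" shows "D (X - Y) Z = D X Z - D Y Z"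
  using D_add1[OF VF_diff[OF assms(1,2)] assms(2,3)] by simp

lemma D_diff2:
  assumes "X \<in> VF" "Y \<in> VF" "Z \<in> VF" shows "D X (Y - Z) = D X Y - D X Z"
  using D_add2[OF assms(1) VF_diff[OF assms(2,3)] assms(3)] by simp

lemma D_zero2: "X \<in> VF \<Longrightarrow> D X 0 = 0"
  using D_diff2[of X X X] by simp

lemma lie_VF: "X \<in> VF \<Longrightarrow> Y \<in> VF \<Longrightarrow> lie_bracket X Y \<in> VF"
  by (simp add: lie_bracket_D VF_diff D_VF)

section \<open>Linearity and symmetries of the curvature\<close>

lemma curvature_VF: "X \<in> VF \<Longrightarrow> Y \<in> VF \<Longrightarrow> Z \<in> VF \<Longrightarrow> R X Y Z \<in> VF"
  by (simp add: curvature_def VF_diff D_VF lie_VF)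

lemma curvature_diff1:
  "X \<in> VF \<Longrightarrow> X' \<in> VF \<Longrightarrow> Y \<in> VF \<Longrightarrow> Z \<in> VF \<Longrightarrow> R (X - X') Y Z = R X Y Z - R X' Y Z"
  by (simp add: curvature_def lie_bracket_D D_diff1 D_diff2 VF_diff D_VF)

lemma curvature_swap:
  "X \<in> VF \<Longrightarrow> Y \<in> VF \<Longrightarrow> Z \<in> VF \<Longrightarrow> R X Y Z = - R Y X Z"
  by (simp add: curvature_def lie_bracket_D D_diff1 D_VF)

lemma curvature_diff3:
  "X \<in> VF \<Longrightarrow> Y \<in> VF \<Longrightarrow> Z \<in> VF \<Longrightarrow> Z' \<in> VF \<Longrightarrow> R X Y (Z - Z') = R X Y Z - R X Y Z'"
  by (simp add: curvature_def D_diff2 lie_VF D_VF algebra_simps)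

lemma curvature_cscale3:
  "X \<in> VF \<Longrightarrow> Y \<in> VF \<Longrightarrow> Z \<in> VF \<Longrightarrow> R X Y ((\<lambda>_. c) \<odot> Z) = (\<lambda>_. c) \<odot> R X Y Z"
  by (simp add: curvature_def D_cscale2 lie_VF D_VF)
     (simp add: fun_eq_iff fun_scale_def algebra_simps)

text \<open>Vanishing torsion turns the cyclic sum of curvatures into the cyclic sum of double
  brackets, which is zero by the Jacobi identity.\<close>

lemma bianchi:
  assumes "X \<in> VF" "Y \<in> VF" "Z \<in> VF"
  shows "R X Y Z + R Y Z X + R Z X Y = 0"
proof -
  note VFs = assms VF_add VF_diff D_VF lie_VF curvature_VF
  have "R X Y Z + R Y Z X + R Z X Y = lie_bracket X (lie_bracket Y Z)
      + lie_bracket Y (lie_bracket Z X) + lie_bracket Z (lie_bracket X Y)"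
    by (simp add: curvature_def lie_bracket_D D_diff1 D_diff2 VFs algebra_simps)
  also have "\<dots> = 0"
    by (rule VF_eqI) (auto simp: VFs VF_zero[OF assms(1)] jacobi[OF assms])
  finally show ?thesis .
qed

text \<open>Metric compatibility is applied twice to the function \<open>mf Z W\<close>, and the
  result is compared with its derivative along the bracket.\<close>

lemma curvature_metric_skew:
  assumes "X \<in> VF" "Y \<in> VF" "Z \<in> VF" "W \<in> VF"
  shows "mf (R X Y Z) W p = - mf (R X Y W) Z p"
proof -
  note VFs = assms VF_diff D_VF lie_VF
  \<comment> \<open>The two middle terms together are symmetric in \<open>X\<close> and
    \<open>Y\<close>, hence disappear on antisymmetrising.\<close>
  have 1: "X p (\<lambda>q. Y q (mf Z W)) = mf (D X (D Y Z)) W p + mf (D Y Z) (D X W) p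
      + mf (D X Z) (D Y W) p + mf Z (D X (D Y W)) p" if "X \<in> VF" "Y \<in> VF" for X Y
    by (simp add: D_metric VF_fun_add mf_F assms that D_VF)
  have "lie_bracket X Y p (mf Z W) = X p (\<lambda>q. Y q (mf Z W)) - Y p (\<lambda>q. X q (mf Z W))"
    by (simp add: lie_bracket_def)
  then have "mf (R X Y Z) W p + mf Z (R X Y W) p = 0"
    using 1[OF assms(1,2)] 1[OF assms(2,1)] D_metric[OF lie_VF[OF assms(1,2)] assms(3,4), of p]
    by (simp add: curvature_def mf_diff mf_sym[of Z] VFs)
  then show ?thesis
    using mf_sym[of Z "R X Y W" p] VFs curvature_VF by simp
qed

text \<open>By the first Bianchi identity \<open>g (R X \<zeta> Z) W\<close> is symmetric in \<open>X\<close> and \<open>Z\<close>; it is skew in \<open>Z\<close> and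
  \<open>W\<close>, and a trilinear form with both symmetries is zero.\<close>

lemma curvature_zero_of_annihilated:
  assumes \<zeta>: "\<zeta> \<in> VF" "\<And>X Y. X \<in> VF \<Longrightarrow> Y \<in> VF \<Longrightarrow> R X Y \<zeta> = 0"
    and XZ: "X \<in> VF" "Z \<in> VF"
  shows "R X \<zeta> Z = 0"
proof -
  have sym: "R X \<zeta> Z = R Z \<zeta> X" if "X \<in> VF" "Z \<in> VF" for X Z
    using bianchi[OF that(1) \<zeta>(1) that(2)] \<zeta>(2)[OF that(2,1)]
      curvature_swap[OF \<zeta>(1) that(2,1)] by simp
  have skew: "mf (R X \<zeta> Z) W p = - mf (R X \<zeta> W) Z p"
    if "X \<in> VF" "Z \<in> VF" "W \<in> VF" for X Z W p
    using curvature_metric_skew[OF that(1) \<zeta>(1) that(2,3)] .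
  have "mf (R X \<zeta> Z) W p = 0" if W: "W \<in> VF" for W p
  proof -
    have "mf (R X \<zeta> Z) W p = - mf (R W \<zeta> X) Z p"
      using skew[OF XZ W] sym[OF XZ(1) W] by metis
    also have "\<dots> = mf (R Z \<zeta> W) X p"
      using skew[OF W XZ] sym[OF XZ(2) W] by simp
    also have "\<dots> = - mf (R X \<zeta> Z) W p"
      using skew[OF XZ(2) W XZ(1)] sym[OF XZ] by metis
    finally show ?thesis by simp
  qed
  then show ?thesis
    using mf_definite curvature_VF[OF XZ(1) \<zeta>(1) XZ(2)] by simp
qed

end

section \<open>The projective semi-symmetric connection\<close>

locale parallel_unit = levi_civita M A g D
  for M :: "'a topology" and A :: "('a, 'e::euclidean_space) chart set"
    and g :: "'a metric_field" and D :: "'a connection" +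
  fixes \<xi> :: "'a vfield" and n :: nat
  assumes n_pos: "n > 0"
    and \<xi>_VF: "\<xi> \<in> vector_fields M A" and unit: "unit_vector_field M g \<xi>"
    and parallel: "parallel_vector_field M A D \<xi>"
begin

abbreviation \<pi> :: "'a vfield \<Rightarrow> 'a \<Rightarrow> real" where "\<pi> X \<equiv> metric_fun M g X \<xi>"
abbreviation D' :: "'a connection" where "D' \<equiv> projective_semi_symmetric_connection n \<pi> D"
abbreviation R' :: "'a vfield \<Rightarrow> 'a vfield \<Rightarrow> 'a vfield \<Rightarrow> 'a vfield" where
  "R' \<equiv> curvature D'"

text \<open>With \<phi> and \<psi> as in the definition of the connection, \<psi> + \<phi> is
  \<open>a\<close> times \<pi> and \<psi> - \<phi> is \<open>b\<close> times \<pi>; these are the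
  coefficients seen in \<open>D'_eq\<close>.\<close>

definition a :: real where "a = n / (n + 1)"
definition b :: real where "b = - 1 / (n + 1)"

lemma a_nonzero: "a \<noteq> 0"
  using n_pos by (simp add: a_def add_nonneg_eq_0_iff)

lemma \<pi>_\<xi>: "p \<in> topspace M \<Longrightarrow> \<pi> \<xi> p = 1"
  using unit by (simp add: unit_vector_field_def)

lemma D_\<xi>: "X \<in> VF \<Longrightarrow> D X \<xi> = 0"
  using parallel by (simp add: parallel_vector_field_def)

text \<open>The form \<pi> is parallel because \<xi> is: the term with \<open>D X \<xi>\<close> in
  the product rule is zero.\<close>

lemma derivative_\<pi>: "X \<in> VF \<Longrightarrow> Y \<in> VF \<Longrightarrow> X p (\<pi> Y) = \<pi> (D X Y) p"
  by (simp add: D_metric \<xi>_VF D_\<xi> mf_zero)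

text \<open>Since \<open>D X\<close> only differentiates the coefficient \<open>f\<close>, the
  curvature is \<xi> times the commutator of \<open>X\<close> and \<open>Y\<close> on
  \<open>f\<close> minus the bracket applied to \<open>f\<close>. This special case stands in for
  general tensoriality in the third slot.\<close>

lemma curvature_scaled_\<xi>:
  assumes "f \<in> F" "X \<in> VF" "Y \<in> VF" shows "R X Y (f \<odot> \<xi>) = 0"
proof -
  have D: "D X (f \<odot> \<xi>) = (\<lambda>p. X p f) \<odot> \<xi>" if "X \<in> VF" "f \<in> F" for X f
    by (simp add: D_scale2 that \<xi>_VF D_\<xi>) (simp add: fun_eq_iff fun_scale_def)
  show ?thesis
    by (simp add: curvature_def D assms VF_apply lie_VF)
       (simp add: lie_bracket_def fun_scale_def fun_eq_iff algebra_simps)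
qed

lemma curvature_\<xi>: "X \<in> VF \<Longrightarrow> Y \<in> VF \<Longrightarrow> R X Y \<xi> = 0"
  by (simp add: curvature_def D_\<xi> lie_VF D_zero2)

lemma \<pi>_curvature:
  assumes "X \<in> VF" "Y \<in> VF" "Z \<in> VF" shows "\<pi> (R X Y Z) p = 0"
  by (simp add: curvature_metric_skew[OF assms \<xi>_VF] curvature_\<xi> assms mf_zero)

lemma D'_eq: "D' X Y = D X Y + (\<lambda>p. a * \<pi> Y p) \<odot> X + (\<lambda>p. b * \<pi> X p) \<odot> Y"
proof -
  define c where "c = (real n - 1) / (2 * (real n + 1))"
  have ab: "a = c + 1 / 2" "b = c - 1 / 2"
    by (simp_all add: a_def b_def c_def field_simps)
  show ?thesis
    unfolding projective_semi_symmetric_connection_def c_def[symmetric] Let_def ab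
    by (simp add: fun_eq_iff fun_scale_def algebra_simps)
qed

lemma c\<pi>_F: "X \<in> VF \<Longrightarrow> (\<lambda>p. c * \<pi> X p) \<in> F"
  by (simp add: F_cmult mf_F \<xi>_VF)

lemma D'_VF: "X \<in> VF \<Longrightarrow> Y \<in> VF \<Longrightarrow> D' X Y \<in> VF"
  by (simp add: D'_eq VF_add VF_scale c\<pi>_F D_VF)

section \<open>Curvature of the projective semi-symmetric connection\<close>

lemma D'_D':
  assumes "X \<in> VF" "Y \<in> VF" "Z \<in> VF"
  shows "D' X (D' Y Z) p h = D X (D Y Z) p h
    + a * \<pi> (D X Z) p * Y p h + a * \<pi> Z p * D X Y p h
    + b * \<pi> (D X Y) p * Z p h + b * \<pi> Y p * D X Z p h
    + a * (\<pi> (D Y Z) p + (a + b) * \<pi> Y p * \<pi> Z p) * X p h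
    + b * \<pi> X p * (D Y Z p h + a * \<pi> Z p * Y p h + b * \<pi> Y p * Z p h)"
proof -
  note VFs = assms VF_add VF_scale c\<pi>_F D_VF D'_VF \<xi>_VF
  have "\<pi> (D' Y Z) p = \<pi> (D Y Z) p + (a + b) * \<pi> Y p * \<pi> Z p"
    by (simp add: D'_eq mf_add mf_scale VFs algebra_simps)
  moreover have "D X (D' Y Z) p h = D X (D Y Z) p h
      + a * \<pi> (D X Z) p * Y p h + a * \<pi> Z p * D X Y p h
      + b * \<pi> (D X Y) p * Z p h + b * \<pi> Y p * D X Z p h"
    by (simp add: D'_eq D_add2 D_scale2 VFs VF_fun_cmult mf_F derivative_\<pi>)
       (simp add: fun_scale_def)
  ultimately show ?thesis
    \<comment> \<open>Only the outer \<open>D'\<close> is unfolded first, so that the two facts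
      about \<open>D' Y Z\<close> apply before the inner one is expanded.\<close>
    by (subst D'_eq) (simp add: fun_scale_def, simp add: D'_eq fun_scale_def)
qed

text \<open>After antisymmetrising \<open>D'_D'\<close>, the coefficient of \<open>X\<close> is
  \<pi>(Y) \<pi>(Z) times \<open>a * (a + b) - a * b\<close>, so \<open>b\<close> drops out; the
  terms with derivatives cancel among themselves or against the bracket.\<close>

lemma curvature'_eq:
  assumes "X \<in> VF" "Y \<in> VF" "Z \<in> VF"
  shows "R' X Y Z p h = R X Y Z p h + a\<^sup>2 * \<pi> Z p * (\<pi> Y p * X p h - \<pi> X p * Y p h)"
proof -
  have "D' (lie_bracket X Y) Z p h = D (lie_bracket X Y) Z p h
      + a * \<pi> Z p * (D X Y p h - D Y X p h) + b * (\<pi> (D X Y) p - \<pi> (D Y X) p) * Z p h"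
    by (simp add: D'_eq fun_scale_def lie_bracket_D assms mf_diff D_VF \<xi>_VF)
  then show ?thesis
    by (simp add: curvature_def D'_D' assms) (simp add: algebra_simps power2_eq_square)
qed

lemma curvature'_VF:
  assumes "X \<in> VF" "Y \<in> VF" "Z \<in> VF" shows "R' X Y Z \<in> VF"
  by (simp add: curvature_def VF_diff D'_VF lie_VF assms)

lemma \<pi>_curvature':
  assumes "X \<in> VF" "Y \<in> VF" "Z \<in> VF" shows "\<pi> (R' X Y Z) p = 0"
proof -
  have "R' X Y Z = R X Y Z + (\<lambda>p. a\<^sup>2 * \<pi> Z p * \<pi> Y p) \<odot> X - (\<lambda>p. a\<^sup>2 * \<pi> Z p * \<pi> X p) \<odot> Y"
    by (simp add: fun_eq_iff curvature'_eq[OF assms] fun_scale_def algebra_simps)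
  moreover have "(\<lambda>p. a\<^sup>2 * \<pi> Z p * \<pi> W p) \<in> F" if "W \<in> VF" for W
    using F_mult[OF c\<pi>_F[OF assms(3)] mf_F[OF that \<xi>_VF]] .
  ultimately show ?thesis
    by (simp add: mf_diff mf_add mf_scale VF_add VF_scale curvature_VF \<pi>_curvature assms \<xi>_VF)
qed

section \<open>The two implications\<close>

lemma semi_symmetric_of_flat:
  assumes "flat_connection M A D" shows "semi_symmetric M A D'"
proof -
  have eq: "R' X Y Z p h = a\<^sup>2 * \<pi> Z p * (\<pi> Y p * X p h - \<pi> X p * Y p h)"
    if "X \<in> VF" "Y \<in> VF" "Z \<in> VF" for X Y Z p h
    using assms that by (simp add: curvature'_eq flat_connection_def)
  show ?thesis
    unfolding semi_symmetric_def
  proof (intro ballI ext)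
    fix X Y Z U V p h
    assume VFs: "X \<in> VF" "Y \<in> VF" "Z \<in> VF" "U \<in> VF" "V \<in> VF"
    \<comment> \<open>The third argument enters through \<pi>, which vanishes on values of
      \<open>R'\<close>.\<close>
    have "R' X Y (R' Z U V) p h = 0" "R' Z U (R' X Y V) p h = 0"
      by (simp_all add: eq[of _ _ "R' _ _ _"] VFs curvature'_VF \<pi>_curvature')
    \<comment> \<open>These two terms cancel: up to opposite signs, both are the same multiple of
      \<pi>(V) \<pi>(U) \<pi>(Z) (\<pi>(Y) X - \<pi>(X) Y).\<close>
    moreover have "R' (R' X Y Z) U V p h = a\<^sup>2 * \<pi> V p * \<pi> U p * R' X Y Z p h"
      "R' Z (R' X Y U) V p h = - a\<^sup>2 * \<pi> V p * \<pi> Z p * R' X Y U p h"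
      by (simp_all add: eq[of "R' _ _ _"] eq[of _ "R' _ _ _"] VFs curvature'_VF \<pi>_curvature')
    ultimately show "(R' X Y (R' Z U V) - R' (R' X Y Z) U V - R' Z (R' X Y U) V
        - R' Z U (R' X Y V)) p h = 0 p h"
      by (simp add: eq VFs)
  qed
qed

lemma curvature_orthogonal_zero:
  assumes semi: "semi_symmetric M A D'"
    and VFs: "X \<in> VF" "Z \<in> VF" "U \<in> VF"
    and orth: "\<pi> X = 0" "\<pi> Z = 0" "\<pi> U = 0"
  shows "R Z U X = 0"
proof -
  note 0 = VF_zero[OF \<xi>_VF]
  have R\<xi>: "R W \<xi> V = 0" if "W \<in> VF" "V \<in> VF" for W V
    using curvature_zero_of_annihilated[OF \<xi>_VF curvature_\<xi> that] .
  have 1: "R' Z U \<xi> = 0"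
    by (simp add: fun_eq_iff curvature'_eq VFs \<xi>_VF curvature_\<xi> orth)
  have 2: "R' X \<xi> Z = 0" "R' X \<xi> U = 0"
    by (simp_all add: fun_eq_iff curvature'_eq VFs \<xi>_VF R\<xi> orth)
  \<comment> \<open>Off \<open>topspace M\<close> the value of \<pi> at \<xi> is 0 instead of 1, but
    there \<open>X\<close> vanishes as well.\<close>
  have "R' X \<xi> \<xi> p h = a\<^sup>2 * X p h" for p h
    using \<pi>_\<xi>[of p] VF_outside[OF VFs(1), of p h]
    by (cases "p \<in> topspace M") (simp_all add: curvature'_eq VFs \<xi>_VF R\<xi> orth)
  then have 3: "R' X \<xi> \<xi> = (\<lambda>_. a\<^sup>2) \<odot> X"
    by (simp add: fun_eq_iff fun_scale_def)
  have "R' X \<xi> (R' Z U \<xi>) - R' (R' X \<xi> Z) U \<xi> - R' Z (R' X \<xi> U) \<xi> - R' Z U (R' X \<xi> \<xi>) = 0"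
    using semi VFs \<xi>_VF unfolding semi_symmetric_def by blast
  \<comment> \<open>Zero arguments are handled through the explicit formula for \<open>R'\<close>,
    since its linearity has not been established.\<close>
  moreover have "R' X \<xi> 0 = 0"
    by (simp add: fun_eq_iff curvature'_eq VFs \<xi>_VF 0 R\<xi> mf_zero)
  moreover have "R' 0 U \<xi> = 0" "R' Z 0 \<xi> = 0"
    by (simp_all add: fun_eq_iff curvature'_eq VFs \<xi>_VF 0 curvature_\<xi> mf_zero)
  moreover have "R' Z U ((\<lambda>_. a\<^sup>2) \<odot> X) = (\<lambda>_. a\<^sup>2) \<odot> R Z U X"
    by (simp add: fun_eq_iff curvature'_eq VFs VF_cscale curvature_cscale3 orth)
  ultimately have "(\<lambda>_. a\<^sup>2) \<odot> R Z U X = 0"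
    using 1 2 3 by simp
  then show ?thesis
    using a_nonzero by (simp add: fun_eq_iff fun_scale_def)
qed

text \<open>Each argument is split into its components along and orthogonal to \<xi>. The former
  contribute nothing to \<open>R\<close>, which leaves the orthogonal case already settled.\<close>

lemma flat_of_semi_symmetric:
  assumes "semi_symmetric M A D'" shows "flat_connection M A D"
  unfolding flat_connection_def
proof (intro ballI)
  fix X Y Z assume VFs: "X \<in> VF" "Y \<in> VF" "Z \<in> VF"
  define v h where "v W = \<pi> W \<odot> \<xi>" and "h W = W - \<pi> W \<odot> \<xi>" for W
  have v: "v W \<in> VF" if "W \<in> VF" for W
    by (simp add: v_def VF_scale mf_F that \<xi>_VF)
  have h: "h W \<in> VF" if "W \<in> VF" for W
    using v[OF that] that by (simp add: h_def v_def VF_diff)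
  have hv: "h W = W - v W" for W by (simp add: h_def v_def)
  have \<pi>h: "\<pi> (h W) = 0" if "W \<in> VF" for W
  proof
    fix p
    show "\<pi> (h W) p = 0 p"
      using \<pi>_\<xi>[of p] v[OF that] that
      by (cases "p \<in> topspace M")
         (simp_all add: hv mf_diff v_def mf_scale \<xi>_VF, simp add: metric_fun_def)
  qed
  have v3: "R X Y (v W) = 0" if "X \<in> VF" "Y \<in> VF" "W \<in> VF" for X Y W
    unfolding v_def using curvature_scaled_\<xi>[OF mf_F[OF that(3) \<xi>_VF] that(1,2)] .
  \<comment> \<open>The field \<open>v W\<close> is itself annihilated by the curvature, by
    \<open>v3\<close>, so it can serve as \<open>\<zeta>\<close>; tensoriality in the second slot is
    thereby avoided.\<close>
  have v2: "R X (v W) Z = 0" if "X \<in> VF" "Z \<in> VF" "W \<in> VF" for X Z W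
    using curvature_zero_of_annihilated[OF v[OF that(3)] _ that(1,2)] v3 that(3) by blast
  have h1: "R (h W) Y Z = R W Y Z" if "W \<in> VF" "Y \<in> VF" "Z \<in> VF" for W Y Z
    using curvature_swap[of "v W" Y Z] v2[of Y Z W] that v
    by (simp add: hv curvature_diff1)
  have h2: "R Y (h W) Z = R Y W Z" if "W \<in> VF" "Y \<in> VF" "Z \<in> VF" for W Y Z
    using curvature_swap[of Y "h W" Z] curvature_swap[of Y W Z] h1 h that by metis
  have h3: "R Y Z (h W) = R Y Z W" if "W \<in> VF" "Y \<in> VF" "Z \<in> VF" for W Y Z
    using v3[of Y Z W] that v by (simp add: hv curvature_diff3)
  have "R X Y Z = R (h X) (h Y) (h Z)"
    using h1 h2 h3 h VFs by simp
  also have "\<dots> = 0"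
    by (simp add: curvature_orthogonal_zero[OF assms] h \<pi>h VFs)
  finally show "R X Y Z = 0" .
qed

end

theorem theorem4p2:
  fixes M :: "'a topology"
    and A :: "('a, 'e::euclidean_space) chart set"
    and g :: "'a metric_field"
    and D :: "'a connection"
    and \<xi> :: "'a vfield"
  assumes "riemannian_manifold M A g"
    and "DIM('e) > 2"
    and "levi_civita_connection M A g D"
    and "\<xi> \<in> vector_fields M A"
    and "unit_vector_field M g \<xi>"
    and "parallel_vector_field M A D \<xi>"
  shows "semi_symmetric M A
           (projective_semi_symmetric_connection DIM('e) (\<lambda>X. metric_fun M g X \<xi>) D)
         \<longleftrightarrow> flat_connection M A D"
proof -
  interpret parallel_unit M A g D \<xi> "DIM('e)"
    using assms by unfold_locales (auto simp: riemannian_manifold_def)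
  show ?thesis
    using semi_symmetric_of_flat flat_of_semi_symmetric by blast
qed

end
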